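(* Let $G$ be a regular graph on $n$ vertices that is not the empty graph $\overline{K_n}$ (i.e. $G$ has at least one edge), with adjacency eigenvalues $\lambda_1\ge\cdots\ge\lambda_n$. Then $$\frac12\mathcal{E}(G)\ge n-H(G),\qquad\text{where } H(G)=n\frac{-\lambda_n}{\lambda_1-\lambda_n}.$$
   Context: Graphs are finite, simple, undirected. $\mathcal{E}(G)$ is the energy of $G$: the sum of the absolute values of the adjacency eigenvalues of $G$. $H(G)$ is Hoffman's ratio number. *)

theory Defs
  imports
    "Graph_Theory.Digraph"
    "Jordan_Normal_Form.Char_Poly"
    "HOL-Library.Multiset"
begin

text \<open>
  A finite simple undirected graph is an instance of the locale \<^locale>\<open>graph\<close>: a finite,
  loop-free, symmetric digraph without multiple arcs. An undirected edge is a pair of opposite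
  arcs, so the degree of a vertex is its out-degree.
\<close>

definition regular :: "('a, 'b) pre_digraph \<Rightarrow> bool" where
  "regular G \<longleftrightarrow> (\<exists>k. \<forall>v \<in> verts G. out_degree G v = k)"

definition vertex_list :: "('a, 'b) pre_digraph \<Rightarrow> 'a list" where
  "vertex_list G = (SOME vs. distinct vs \<and> set vs = verts G)"

text \<open>
  The choice of the enumeration only matters up to simultaneous permutation of rows and columns,
  which does not change the characteristic polynomial.
\<close>

definition adjacency_matrix :: "('a, 'b) pre_digraph \<Rightarrow> real mat" where
  "adjacency_matrix G =
     (let vs = vertex_list G; n = card (verts G)
      in mat n n (\<lambda>(i, j). if vs ! i \<rightarrow>\<^bsub>G\<^esub> vs ! j then 1 else 0))"

text \<open>
  The eigenvalues in non-increasing order, repeated according to multiplicity. The matrix is real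
  symmetric for a graph, so its characteristic polynomial splits over the reals and the list has
  length \<^term>\<open>card (verts G)\<close>.
\<close>

definition adjacency_eigenvalues :: "('a, 'b) pre_digraph \<Rightarrow> real list" where
  "adjacency_eigenvalues G =
     rev (sorted_list_of_multiset (proots (char_poly (adjacency_matrix G))))"

text \<open>Indices start at 1, so that the eigenvalues are numbered from 1 to the order of the graph.\<close>

definition adjacency_eigenvalue :: "('a, 'b) pre_digraph \<Rightarrow> nat \<Rightarrow> real" where
  "adjacency_eigenvalue G i = adjacency_eigenvalues G ! (i - 1)"

definition graph_energy :: "('a, 'b) pre_digraph \<Rightarrow> real" where
  "graph_energy G = (\<Sum>x\<leftarrow>adjacency_eigenvalues G. \<bar>x\<bar>)"

definition hoffman_ratio :: "('a, 'b) pre_digraph \<Rightarrow> real" where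
  "hoffman_ratio G =
     (let n = card (verts G);
          l1 = adjacency_eigenvalue G 1;
          ln = adjacency_eigenvalue G n
      in real n * (- ln / (l1 - ln)))"

end

theory Submission
  imports Defs "Jordan_Normal_Form.Schur_Decomposition"
begin

text \<open>
  Let the graph be \<open>k\<close>-regular. The eigenvalues sum to zero, so the positive and the negative ones
  each contribute half of the energy \<open>E\<close>. The sum of their squares is the trace \<open>n * k\<close> of the squared
  adjacency matrix, and bounding one factor of each square by \<open>\<lambda>\<^sub>1\<close> or by \<open>- \<lambda>\<^sub>n\<close>, according to sign,
  gives \<open>n * k \<le> (\<lambda>\<^sub>1 - \<lambda>\<^sub>n) * E / 2\<close>. Since \<open>\<lambda>\<^sub>1 \<le> k\<close>, the claim follows, because
  \<open>n - H = n * \<lambda>\<^sub>1 / (\<lambda>\<^sub>1 - \<lambda>\<^sub>n)\<close>.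
\<close>

section \<open>Traces, similarity and sums of powers of eigenvalues\<close>

definition mat_trace :: "'a :: comm_monoid_add mat \<Rightarrow> 'a" where
  "mat_trace A = (\<Sum>i<dim_row A. A $$ (i, i))"

lemma index_mult_mat_sum:
  assumes "A \<in> carrier_mat n m" "B \<in> carrier_mat m l" "i < n" "j < l"
  shows "(A * B) $$ (i, j) = (\<Sum>k<m. A $$ (i, k) * B $$ (k, j))"
  using assms by (auto simp: scalar_prod_def atLeast0LessThan intro!: sum.cong)

lemma mat_trace_mult:
  assumes "A \<in> carrier_mat n m" "B \<in> carrier_mat m n"
  shows "mat_trace (A * B) = (\<Sum>i<n. \<Sum>k<m. A $$ (i, k) * B $$ (k, i))"
  using assms by (auto simp: mat_trace_def index_mult_mat_sum[OF assms] simp del: index_mult_mat(1))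

lemma mat_trace_comm:
  fixes A :: "'a :: comm_semiring_0 mat"
  assumes "A \<in> carrier_mat n m" "B \<in> carrier_mat m n"
  shows "mat_trace (A * B) = mat_trace (B * A)"
  unfolding mat_trace_mult[OF assms] mat_trace_mult[OF assms(2,1)]
  by (subst sum.swap) (simp add: mult.commute)

text \<open>Cyclicity moves \<open>Q\<close> to the front of \<open>P * B * Q\<close>, where it
  cancels against \<open>P\<close>.\<close>

lemma mat_trace_similar:
  fixes A :: "'a :: comm_ring_1 mat"
  assumes "similar_mat A B"
  shows "mat_trace A = mat_trace B"
proof -
  from similar_matD[OF assms] obtain n P Q where
    c: "A \<in> carrier_mat n n" "B \<in> carrier_mat n n" "P \<in> carrier_mat n n" "Q \<in> carrier_mat n n"
    and QP: "Q * P = 1\<^sub>m n" and A: "A = P * B * Q" by auto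
  have "mat_trace A = mat_trace (Q * (P * B))"
    unfolding A using c by (intro mat_trace_comm) auto
  also have "Q * (P * B) = (Q * P) * B" using c by simp
  also have "\<dots> = B" using c QP by simp
  finally show ?thesis .
qed

text \<open>For \<open>k \<noteq> i\<close> one of the positions \<open>(i, k)\<close> and
  \<open>(k, i)\<close> lies below the diagonal, so only the squared diagonal entries
  survive.\<close>

lemma mat_trace_square_upper_triangular:
  fixes B :: "'a :: comm_ring_1 mat"
  assumes B: "B \<in> carrier_mat n n" and ut: "upper_triangular B"
  shows "mat_trace (B * B) = (\<Sum>x\<leftarrow>diag_mat B. x\<^sup>2)"
proof -
  have "(\<Sum>k<n. B $$ (i, k) * B $$ (k, i)) = (B $$ (i, i))\<^sup>2" if i: "i < n" for i
  proof -
    have "B $$ (i, k) * B $$ (k, i) = 0" if "k < n" "k \<noteq> i" for k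
      using ut B i that unfolding upper_triangular_def
      by (metis carrier_matD(1) mult_zero_left mult_zero_right nat_neq_iff)
    then have "(\<Sum>k<n. B $$ (i, k) * B $$ (k, i)) = (\<Sum>k\<in>{i}. B $$ (i, k) * B $$ (k, i))"
      using i by (intro sum.mono_neutral_right) auto
    then show ?thesis by (simp add: power2_eq_square)
  qed
  then show ?thesis
    unfolding mat_trace_mult[OF B B] using B
    by (simp add: diag_mat_def interv_sum_list_conv_sum_set_nat atLeast0LessThan comp_def)
qed

text \<open>Schur decomposition makes \<open>A\<close> similar to a triangular \<open>B\<close> with
  diagonal exactly \<open>es\<close>, multiplicities included. The same \<open>P\<close> and
  \<open>Q\<close> conjugate \<open>A * A\<close> to \<open>B * B\<close>, so both traces can be
  read off \<open>B\<close>.\<close>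

lemma
  fixes A :: "real mat"
  assumes A: "A \<in> carrier_mat n n" and split: "char_poly A = (\<Prod>e\<leftarrow>es. [:- e, 1:])"
  shows sum_list_eigenvalues: "sum_list es = mat_trace A"
    and sum_list_eigenvalues_square: "(\<Sum>e\<leftarrow>es. e\<^sup>2) = mat_trace (A * A)"
proof -
  obtain B P Q where "schur_decomposition A es = (B, P, Q)"
    by (cases "schur_decomposition A es") auto
  from schur_decomposition[OF A split this]
  have wit: "similar_mat_wit A B P Q" and sim: "similar_mat A B" and ut: "upper_triangular B" and diag: "diag_mat B = es"
    by (auto simp: similar_mat_def)
  from similar_matD[OF sim] A have B: "B \<in> carrier_mat n n" by auto
  have "mat_trace A = mat_trace B" by (rule mat_trace_similar[OF sim])
  also have "\<dots> = sum_list (diag_mat B)"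
    using B by (simp add: mat_trace_def diag_mat_def interv_sum_list_conv_sum_set_nat atLeast0LessThan)
  finally show "sum_list es = mat_trace A" by (simp add: diag)
  have "similar_mat (A * A) (B * B)"
    using similar_mat_wit_pow[OF wit, of 2] A B by (auto simp: similar_mat_def numeral_2_eq_2)
  then show "(\<Sum>e\<leftarrow>es. e\<^sup>2) = mat_trace (A * A)"
    using mat_trace_similar mat_trace_square_upper_triangular[OF B ut] diag by metis
qed

section \<open>Real spectra of symmetric matrices\<close>

lemma symmetric_real_eigenvalue_real:
  fixes A :: "real mat"
  assumes A: "A \<in> carrier_mat n n" and sym: "\<And>i j. i < n \<Longrightarrow> j < n \<Longrightarrow> A $$ (i, j) = A $$ (j, i)"
    and ev: "eigenvalue (map_mat complex_of_real A) z"
  shows "z \<in> \<real>"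
proof -
  from ev A obtain v where v: "v \<in> carrier_vec n" "v \<noteq> 0\<^sub>v n"
    and Av: "map_mat complex_of_real A *\<^sub>v v = z \<cdot>\<^sub>v v"
    unfolding eigenvalue_def eigenvector_def by auto
  have row: "(\<Sum>j<n. complex_of_real (A $$ (i, j)) * v $ j) = z * v $ i" if "i < n" for i
    using arg_cong[OF Av, of "\<lambda>w. w $ i"] that A v
    by (simp add: scalar_prod_def atLeast0LessThan)
  \<comment> \<open>\<open>q\<close> is the Hermitian form of \<open>A\<close> at \<open>v\<close>,
    and \<open>s\<close> is the squared norm of \<open>v\<close>. The eigenvector equation gives
    \<open>q = z * s\<close>, while conjugation combined with symmetry fixes \<open>q\<close>. Hence
    \<open>z\<close> is a quotient of two reals.\<close>
  define q where "q = (\<Sum>i<n. \<Sum>j<n. A $$ (i, j) * (cnj (v $ i) * v $ j))"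
  define s where "s = (\<Sum>i<n. (cmod (v $ i))\<^sup>2)"
  have "q = (\<Sum>i<n. cnj (v $ i) * (\<Sum>j<n. A $$ (i, j) * v $ j))"
    unfolding q_def by (simp add: sum_distrib_left mult_ac)
  also have "\<dots> = (\<Sum>i<n. z * (v $ i * cnj (v $ i)))"
    by (intro sum.cong refl) (simp add: row)
  also have "\<dots> = z * s"
    unfolding s_def by (simp add: complex_norm_square sum_distrib_left del: of_real_power)
  finally have q: "q = z * s" .
  have "cnj q = (\<Sum>i<n. \<Sum>j<n. A $$ (i, j) * (cnj (v $ j) * v $ i))"
    unfolding q_def by (simp add: mult_ac)
  also have "\<dots> = (\<Sum>j<n. \<Sum>i<n. A $$ (i, j) * (cnj (v $ j) * v $ i))"
    by (rule sum.swap)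
  also have "\<dots> = q"
    unfolding q_def by (intro sum.cong refl) (simp add: sym)
  finally have "q \<in> \<real>" by (simp add: Reals_cnj_iff)
  obtain i where "i < n" "v $ i \<noteq> 0"
    using v by (metis carrier_vecD eq_vecI index_zero_vec)
  then have "s \<noteq> 0"
    unfolding s_def by (subst sum_nonneg_eq_0_iff) auto
  then have "z = q / s" by (simp add: q)
  with \<open>q \<in> \<real>\<close> show ?thesis by simp
qed

text \<open>Over the complex numbers the characteristic polynomial splits, and each root is an
  eigenvalue, hence real. Embedding real polynomials into complex ones is injective, so the
  factorization descends to the reals.\<close>

lemma symmetric_real_char_poly_splits:
  fixes A :: "real mat"
  assumes A: "A \<in> carrier_mat n n" and sym: "\<And>i j. i < n \<Longrightarrow> j < n \<Longrightarrow> A $$ (i, j) = A $$ (j, i)"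
  obtains es where "char_poly A = (\<Prod>e\<leftarrow>es. [:- e, 1:])" "length es = n"
proof -
  interpret of_real_poly: map_poly_inj_comm_ring_hom complex_of_real ..
  let ?C = "map_mat complex_of_real A"
  have C: "?C \<in> carrier_mat n n" using A by simp
  from char_poly_factorized[OF C] obtain as where
    as: "char_poly ?C = (\<Prod>a\<leftarrow>as. [:- a, 1:])" and len: "length as = n" by auto
  have "a \<in> \<real>" if "a \<in> set as" for a
  proof (rule symmetric_real_eigenvalue_real[OF A sym])
    have "poly (char_poly ?C) a = 0"
      unfolding as poly_prod_list using that by (induction as) auto
    then show "eigenvalue ?C a" using eigenvalue_root_char_poly[OF C] by simp
  qed
  then have re: "as = map complex_of_real (map Re as)"
    by (auto intro!: map_idI[symmetric])
  have "map_poly complex_of_real (char_poly A) = char_poly ?C"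
    by (rule of_real_hom.char_poly_hom[OF A, symmetric])
  also have "\<dots> = (\<Prod>a\<leftarrow>map Re as. map_poly complex_of_real [:- a, 1:])"
    unfolding as by (subst re) (simp add: comp_def)
  also have "\<dots> = map_poly complex_of_real (\<Prod>a\<leftarrow>map Re as. [:- a, 1:])"
    by (simp add: of_real_poly.hom_prod_list comp_def)
  finally have "char_poly A = (\<Prod>a\<leftarrow>map Re as. [:- a, 1:])"
    by simp
  then show ?thesis using len by (intro that[of "map Re as"]) simp_all
qed

section \<open>Estimates for eigenvalues and their squares\<close>

lemma nonneg_matrix_eigenvalue_le_row_sum:
  fixes A :: "real mat"
  assumes A: "A \<in> carrier_mat n n" and ev: "eigenvalue A e"
    and nonneg: "\<And>i j. i < n \<Longrightarrow> j < n \<Longrightarrow> 0 \<le> A $$ (i, j)"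
    and row_sum: "\<And>i. i < n \<Longrightarrow> (\<Sum>j<n. A $$ (i, j)) \<le> k"
  shows "e \<le> k"
proof -
  from ev A obtain v where v: "v \<in> carrier_vec n" "v \<noteq> 0\<^sub>v n" and Av: "A *\<^sub>v v = e \<cdot>\<^sub>v v"
    unfolding eigenvalue_def eigenvector_def by auto
  obtain j where j: "j < n" "v $ j \<noteq> 0"
    using v by (metis carrier_vecD eq_vecI index_zero_vec)
  \<comment> \<open>Row \<open>i\<close> of the eigenvector equation is read at a coordinate of
    largest modulus \<open>M\<close>: there the triangle inequality gives
    \<open>\<bar>e\<bar> * M \<le> k * M\<close>, and \<open>M > 0\<close> can be cancelled.\<close>
  define M where "M = Max ((\<lambda>i. \<bar>v $ i\<bar>) ` {..<n})"
  have "M \<in> (\<lambda>i. \<bar>v $ i\<bar>) ` {..<n}"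
    unfolding M_def using j by (intro Max_in) auto
  then obtain i where i: "i < n" "M = \<bar>v $ i\<bar>" by auto
  have le: "\<bar>v $ l\<bar> \<le> M" if "l < n" for l
    unfolding M_def using that by (intro Max_ge) auto
  have M: "0 < M" using le[OF j(1)] j(2) by linarith
  have "e * v $ i = (\<Sum>l<n. A $$ (i, l) * v $ l)"
    using arg_cong[OF Av, of "\<lambda>w. w $ i"] i A v
    by (simp add: scalar_prod_def atLeast0LessThan)
  then have "\<bar>e\<bar> * M = \<bar>\<Sum>l<n. A $$ (i, l) * v $ l\<bar>"
    by (simp add: i(2) abs_mult[symmetric])
  also have "\<dots> \<le> (\<Sum>l<n. A $$ (i, l) * M)"
    using nonneg[OF i(1)] le
    by (intro order_trans[OF sum_abs] sum_mono) (auto simp: abs_mult intro: mult_left_mono)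
  also have "\<dots> \<le> k * M"
    using row_sum[OF i(1)] M by (simp add: sum_distrib_right[symmetric])
  finally have "\<bar>e\<bar> \<le> k" using M by simp
  then show ?thesis by simp
qed

text \<open>A nonnegative \<open>x\<close> has \<open>x * x \<le> b * x\<close>, a negative one
  \<open>x * x \<le> a * x\<close>. Both right-hand sides equal
  \<open>(b - a) / 2 * \<bar>x\<bar> + (b + a) / 2 * x\<close>, whose linear part vanishes in the
  sum.\<close>

lemma sum_squares_le_sum_abs:
  fixes xs :: "real list"
  assumes "\<And>x. x \<in> set xs \<Longrightarrow> a \<le> x \<and> x \<le> b" and "sum_list xs = 0"
  shows "(\<Sum>x\<leftarrow>xs. x\<^sup>2) \<le> (b - a) * (1 / 2 * (\<Sum>x\<leftarrow>xs. \<bar>x\<bar>))"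
proof -
  have "x\<^sup>2 \<le> (b - a) / 2 * \<bar>x\<bar> + (b + a) / 2 * x" if "x \<in> set xs" for x
  proof (cases "0 \<le> x")
    case True
    then have "x * x \<le> b * x" using assms(1)[OF that] by (intro mult_right_mono) auto
    with True show ?thesis by (simp add: power2_eq_square field_simps)
  next
    case False
    then have "x * x \<le> a * x" using assms(1)[OF that] by (intro mult_right_mono_neg) auto
    with False show ?thesis by (simp add: power2_eq_square field_simps)
  qed
  then have "(\<Sum>x\<leftarrow>xs. x\<^sup>2) \<le> (\<Sum>x\<leftarrow>xs. (b - a) / 2 * \<bar>x\<bar> + (b + a) / 2 * x)"
    by (intro sum_list_mono) auto
  also have "\<dots> = (b - a) / 2 * (\<Sum>x\<leftarrow>xs. \<bar>x\<bar>) + (b + a) / 2 * (\<Sum>x\<leftarrow>xs. x)"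
    by (simp only: sum_list_addf sum_list_const_mult)
  finally show ?thesis using assms(2) by simp
qed

section \<open>The adjacency matrix of a graph and its spectrum\<close>

context graph
begin

lemma out_degree_eq_card_neighbours:
  "out_degree G v = card {w \<in> verts G. v \<rightarrow>\<^bsub>G\<^esub> w}"
proof -
  \<comment> \<open>Arcs leaving \<open>v\<close> share their tail, so two with the same head would
    be parallel.\<close>
  have "inj_on (head G) (out_arcs G v)"
    by (rule inj_onI) (auto simp: arc_to_ends_def intro!: no_multi_arcs)
  moreover have "head G ` out_arcs G v = {w \<in> verts G. v \<rightarrow>\<^bsub>G\<^esub> w}"
    by (auto simp: arcs_ends_conv)
  ultimately show ?thesis unfolding out_degree_def by (metis card_image)
qed

lemma vertex_list: "distinct (vertex_list G)" "set (vertex_list G) = verts G"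
proof -
  obtain vs where "distinct vs \<and> set vs = verts G"
    using finite_distinct_list[OF finite_verts] by auto
  then have "distinct (vertex_list G) \<and> set (vertex_list G) = verts G"
    unfolding vertex_list_def by (rule someI)
  then show "distinct (vertex_list G)" "set (vertex_list G) = verts G" by auto
qed

text \<open>Used to reindex sums over matrix positions as sums over vertices.\<close>

lemma bij_betw_vertex_list: "bij_betw ((!) (vertex_list G)) {..<card (verts G)} (verts G)"
  using bij_betw_nth[OF vertex_list(1)] vertex_list distinct_card by metis

lemma adjacency_matrix_carrier: "adjacency_matrix G \<in> carrier_mat (card (verts G)) (card (verts G))"
  by (simp add: adjacency_matrix_def Let_def)

lemma adjacency_matrix_index:
  "i < card (verts G) \<Longrightarrow> j < card (verts G) \<Longrightarrow>
    adjacency_matrix G $$ (i, j) = of_bool (vertex_list G ! i \<rightarrow>\<^bsub>G\<^esub> vertex_list G ! j)"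
  by (simp add: adjacency_matrix_def Let_def)

lemma adjacency_matrix_sym:
  "i < card (verts G) \<Longrightarrow> j < card (verts G) \<Longrightarrow>
    adjacency_matrix G $$ (i, j) = adjacency_matrix G $$ (j, i)"
  using sym_arcs by (auto simp: adjacency_matrix_index symmetric_def dest: symD)

lemma adjacency_matrix_row_sum:
  assumes "i < card (verts G)"
  shows "(\<Sum>j<card (verts G). adjacency_matrix G $$ (i, j)) = out_degree G (vertex_list G ! i)"
proof -
  have "(\<Sum>j<card (verts G). adjacency_matrix G $$ (i, j)) =
      (\<Sum>j<card (verts G). of_bool (vertex_list G ! i \<rightarrow>\<^bsub>G\<^esub> vertex_list G ! j))"
    using assms by (intro sum.cong) (auto simp: adjacency_matrix_index)
  also have "\<dots> = (\<Sum>w\<in>verts G. of_bool (vertex_list G ! i \<rightarrow>\<^bsub>G\<^esub> w))"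
    by (rule sum.reindex_bij_betw[OF bij_betw_vertex_list])
  also have "\<dots> = out_degree G (vertex_list G ! i)"
    by (simp add: out_degree_eq_card_neighbours Int_def)
  finally show ?thesis .
qed

lemma mat_trace_adjacency_matrix: "mat_trace (adjacency_matrix G) = 0"
  using adjacency_matrix_carrier no_loops
  by (fastforce simp: mat_trace_def adjacency_matrix_index arcs_ends_conv)

text \<open>The entries are 0 or 1 and symmetric, so the product of the entries at
  \<open>(i, j)\<close> and \<open>(j, i)\<close> is the entry itself. Each diagonal entry of the
  square is therefore a row sum, that is, a degree.\<close>

lemma mat_trace_adjacency_matrix_square:
  "mat_trace (adjacency_matrix G * adjacency_matrix G) = (\<Sum>v\<in>verts G. real (out_degree G v))"
proof -
  have "mat_trace (adjacency_matrix G * adjacency_matrix G) =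
      (\<Sum>i<card (verts G). \<Sum>j<card (verts G). adjacency_matrix G $$ (i, j))"
    unfolding mat_trace_mult[OF adjacency_matrix_carrier adjacency_matrix_carrier]
    using adjacency_matrix_sym by (intro sum.cong) (auto simp: adjacency_matrix_index)
  also have "\<dots> = (\<Sum>i<card (verts G). real (out_degree G (vertex_list G ! i)))"
    by (simp add: adjacency_matrix_row_sum)
  also have "\<dots> = (\<Sum>v\<in>verts G. real (out_degree G v))"
    by (rule sum.reindex_bij_betw[OF bij_betw_vertex_list])
  finally show ?thesis .
qed

text \<open>The eigenvalue list is built from the roots in the reals, so it is complete only because
  symmetry makes the polynomial split. It is then a permutation of the factor list
  \<open>es\<close>, and the product ignores order.\<close>

lemma
  shows char_poly_adjacency_matrix:
      "char_poly (adjacency_matrix G) = (\<Prod>e\<leftarrow>adjacency_eigenvalues G. [:- e, 1:])"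
    and length_adjacency_eigenvalues: "length (adjacency_eigenvalues G) = card (verts G)"
proof -
  obtain es where es: "char_poly (adjacency_matrix G) = (\<Prod>e\<leftarrow>es. [:- e, 1:])"
    and len: "length es = card (verts G)"
    using symmetric_real_char_poly_splits[OF adjacency_matrix_carrier adjacency_matrix_sym] by blast
  have "proots (\<Prod>e\<leftarrow>es. [:- e, 1:]) = mset es"
  proof (induction es)
    case (Cons e es)
    \<comment> \<open>\<open>proots_mult\<close> adds root multisets only for a nonzero
      product.\<close>
    have "(\<Prod>e\<leftarrow>es. [:- e, 1:]) \<noteq> (0 :: real poly)" by (auto simp: prod_list_zero_iff)
    then show ?case using Cons by (simp add: proots_mult del: mult_pCons_left)
  qed simp
  then have mset: "mset (adjacency_eigenvalues G) = mset es"
    by (simp add: adjacency_eigenvalues_def es)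
  from mset len show "length (adjacency_eigenvalues G) = card (verts G)"
    by (metis size_mset)
  have "(\<Prod>e\<leftarrow>es. [:- e, 1:]) = prod_mset (image_mset (\<lambda>e. [:- e, 1:]) (mset es))"
    by (simp add: prod_mset_prod_list flip: mset_map)
  then show "char_poly (adjacency_matrix G) = (\<Prod>e\<leftarrow>adjacency_eigenvalues G. [:- e, 1:])"
    by (simp add: es prod_mset_prod_list flip: mset mset_map)
qed

lemma adjacency_eigenvalue_bounds:
  assumes "x \<in> set (adjacency_eigenvalues G)"
  shows "adjacency_eigenvalue G (card (verts G)) \<le> x" "x \<le> adjacency_eigenvalue G 1"
proof -
  from assms obtain i where i: "i < card (verts G)" "x = adjacency_eigenvalues G ! i"
    by (metis in_set_conv_nth length_adjacency_eigenvalues)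
  \<comment> \<open>Reversing the ascending list makes it non-increasing, so the eigenvalues
    numbered 1 and \<open>card (verts G)\<close>, at positions 0 and
    \<open>card (verts G) - 1\<close>, are the extremes.\<close>
  have "sorted_wrt (\<ge>) (adjacency_eigenvalues G)"
    by (simp add: adjacency_eigenvalues_def sorted_wrt_rev)
  then have "adjacency_eigenvalues G ! m \<le> adjacency_eigenvalues G ! l"
    if "l \<le> m" "m < card (verts G)" for l m
    using that length_adjacency_eigenvalues by (cases "l = m") (auto simp: sorted_wrt_iff_nth_less)
  with i show "adjacency_eigenvalue G (card (verts G)) \<le> x" "x \<le> adjacency_eigenvalue G 1"
    by (auto simp: adjacency_eigenvalue_def)
qed

lemma sum_adjacency_eigenvalues: "sum_list (adjacency_eigenvalues G) = 0"
  using sum_list_eigenvalues[OF adjacency_matrix_carrier char_poly_adjacency_matrix]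
    mat_trace_adjacency_matrix by simp

lemma sum_adjacency_eigenvalues_square:
  "(\<Sum>x\<leftarrow>adjacency_eigenvalues G. x\<^sup>2) = (\<Sum>v\<in>verts G. real (out_degree G v))"
  using sum_list_eigenvalues_square[OF adjacency_matrix_carrier char_poly_adjacency_matrix]
    mat_trace_adjacency_matrix_square by simp

text \<open>The row sums of the adjacency matrix are degrees, so the row sum bound for nonnegative
  matrices applies.\<close>

lemma adjacency_eigenvalue_le_degree:
  assumes "x \<in> set (adjacency_eigenvalues G)" "\<And>v. v \<in> verts G \<Longrightarrow> out_degree G v \<le> k"
  shows "x \<le> k"
proof (rule nonneg_matrix_eigenvalue_le_row_sum[OF adjacency_matrix_carrier])
  have "poly (char_poly (adjacency_matrix G)) x = 0"
    unfolding char_poly_adjacency_matrix poly_prod_list using assms(1)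
    by (force simp: prod_list_zero_iff)
  then show "eigenvalue (adjacency_matrix G) x"
    using eigenvalue_root_char_poly[OF adjacency_matrix_carrier] by simp
next
  fix i assume "i < card (verts G)"
  then have "vertex_list G ! i \<in> verts G" using bij_betw_vertex_list by (auto simp: bij_betw_def)
  with assms(2) show "(\<Sum>j<card (verts G). adjacency_matrix G $$ (i, j)) \<le> k"
    by (simp add: adjacency_matrix_row_sum \<open>i < card (verts G)\<close>)
qed (simp add: adjacency_matrix_index)

end

section \<open>Combining the estimates for a regular graph\<close>

theorem theorem1p4:
  fixes G :: "('a, 'b) pre_digraph" and n :: nat
  assumes "graph G"
    and "regular G"
    and "n = card (verts G)"
    and "arcs G \<noteq> {}"
  shows "1 / 2 * graph_energy G \<ge> real n - hoffman_ratio G"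
proof -
  interpret graph G by fact
  from \<open>regular G\<close> obtain k where k: "\<And>v. v \<in> verts G \<Longrightarrow> out_degree G v = k"
    by (auto simp: regular_def)
  from \<open>arcs G \<noteq> {}\<close> obtain a where a: "a \<in> arcs G" by auto
  \<comment> \<open>An arc gives its tail positive degree, and by regularity this degree is
    \<open>k\<close>.\<close>
  then have "a \<in> out_arcs G (tail G a)" by simp
  then have "out_degree G (tail G a) > 0"
    unfolding out_degree_def by (metis card_gt_0_iff empty_iff finite_out_arcs)
  with a have k0: "k > 0" by (simp add: k)
  have n0: "n > 0"
    using a unfolding assms(3) by (metis card_gt_0_iff empty_iff finite_verts tail_in_verts)
  define b where "b = adjacency_eigenvalue G 1"
  define c where "c = adjacency_eigenvalue G n"
  define E where "E = 1 / 2 * graph_energy G"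
  have "b \<in> set (adjacency_eigenvalues G)"
    using n0 assms(3) length_adjacency_eigenvalues by (simp add: b_def adjacency_eigenvalue_def)
  then have bk: "b \<le> k" by (rule adjacency_eigenvalue_le_degree) (simp add: k)
  have "(\<Sum>x\<leftarrow>adjacency_eigenvalues G. x\<^sup>2) \<le> (b - c) * E"
    unfolding E_def graph_energy_def
    using adjacency_eigenvalue_bounds sum_adjacency_eigenvalues
    by (intro sum_squares_le_sum_abs) (auto simp: b_def c_def assms(3))
  then have main: "real n * k \<le> (b - c) * E"
    by (simp add: sum_adjacency_eigenvalues_square k assms(3))
  have E: "E \<ge> 0"
    unfolding E_def graph_energy_def by (auto intro!: sum_list_nonneg)
  \<comment> \<open>The left side of \<open>main\<close> is positive, which together with
    \<open>E \<ge> 0\<close> forces \<open>b - c > 0\<close>. Thus the denominator in the Hoffman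
    ratio is nonzero and division behaves as usual.\<close>
  have "0 < (b - c) * E" using main n0 k0 by (meson less_le_trans mult_pos_pos of_nat_0_less_iff)
  then have bc: "b - c > 0" using E by (simp add: zero_less_mult_iff)
  have "real n - hoffman_ratio G = n * b / (b - c)"
    unfolding hoffman_ratio_def Let_def assms(3)[symmetric] b_def[symmetric] c_def[symmetric]
    using bc by (simp add: field_simps)
  \<comment> \<open>Only the numerator is enlarged, by \<open>bk\<close>; the denominator stays
    \<open>b - c\<close> to match \<open>main\<close>.\<close>
  also have "\<dots> \<le> n * k / (b - c)"
    using bk bc by (simp add: divide_right_mono mult_left_mono)
  also have "\<dots> \<le> E"
    using main bc by (simp add: pos_divide_le_eq mult.commute)
  finally show ?thesis by (simp add: E_def)
qed

end
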